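(* Let $F$ be a field (finite or infinite) with $\operatorname{char}(F)\neq 2$. For every involution of the first kind $\circledast$ on the algebra $UT_2(F)$ of $2\times 2$ upper triangular matrices over $F$, $$C(UT_2(F),\circledast)\neq Id(UT_2(F),\circledast)+F .$$
   Context: All algebras are unitary and associative over $F$. An involution on an algebra $A$ is a map $\circledast:A\to A$ with $(a+b)^\circledast=a^\circledast+b^\circledast$, $(ab)^\circledast=b^\circledast a^\circledast$ and $(a^\circledast)^\circledast=a$ for all $a,b\in A$; it is of the first kind if $a^\circledast=a$ for every $a$ in the center $Z(A)$ (so it is then $F$-linear). Let $X=\{x_1,x_2,\ldots\}$ and $X^*=\{x_1^*,x_2^*,\ldots\}$ be disjoint infinite sets, and let $F\langle X\cup X^*\rangle$ be the free unitary associative $F$-algebra freely generated by $X\cup X^*$. For an algebra with involution $(A,\circledast)$: $Id(A,\circledast)$ is the set of all $*$-polynomial identities, i.e. those $f(x_1,x_1^*,\ldots,x_n,x_n^* )\in F\langle X\cup X^*\rangle$ with $f(a_1,a_1^\circledast,\ldots,a_n,a_n^\circledast)=0$ for all $a_1,\ldots,a_n\in A$; $C(A,\circledast)$ is the set of all $*$-central polynomials, i.e. those $f$ with $f(a_1,a_1^\circledast,\ldots,a_n,a_n^\circledast)\in Z(A)$ for all $a_1,\ldots,a_n\in A$. Here $F\subset F\langle X\cup X^*\rangle$ denotes the constant polynomials and $+$ is the sum of vector subspaces. *)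

theory Defs
  imports
    "HOL-Analysis.Analysis"
    "HOL-Library.Poly_Mapping"
    "HOL-Library.Set_Algebras"
begin

locale assoc_algebra = vector_space smul
  for smul :: "'a::field \<Rightarrow> 'b::ring_1 \<Rightarrow> 'b" +
  assumes smul_mult_left: "smul c x * y = smul c (x * y)"
    and smul_mult_right: "x * smul c y = smul c (x * y)"

definition center :: "'b::ring_1 set" where
  "center = {z. \<forall>a. z * a = a * z}"

definition involution :: "('b::ring_1 \<Rightarrow> 'b) \<Rightarrow> bool" where
  "involution \<tau> \<longleftrightarrow>
     (\<forall>a b. \<tau> (a + b) = \<tau> a + \<tau> b) \<and>
     (\<forall>a b. \<tau> (a * b) = \<tau> b * \<tau> a) \<and>
     (\<forall>a. \<tau> (\<tau> a) = a)"

definition first_kind :: "('b::ring_1 \<Rightarrow> 'b) \<Rightarrow> bool" where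
  "first_kind \<tau> \<longleftrightarrow> (\<forall>a\<in>center. \<tau> a = a)"

text \<open>The monomials form the free monoid on the variables, written additively because
  \<open>poly_mapping\<close> takes its convolution product over an additive monoid of exponents.\<close>

instantiation list :: (type) monoid_add
begin

definition zero_list :: "'a list" where "0 = []"
definition plus_list :: "'a list \<Rightarrow> 'a list \<Rightarrow> 'a list" where "xs + ys = xs @ ys"

instance by standard (auto simp: zero_list_def plus_list_def)

end

datatype star_var = X nat | Xstar nat

text \<open>This is \<open>F\<langle>X \<union> X\<^sup>*\<rangle>\<close>; its ring structure is the \<open>ring_1\<close> instance of \<open>poly_mapping\<close>.\<close>

type_synonym 'a star_poly = "star_var list \<Rightarrow>\<^sub>0 'a"

definition constants :: "'a::field star_poly set" where
  "constants = range (Poly_Mapping.single 0)"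

fun var_value :: "('b \<Rightarrow> 'b) \<Rightarrow> (nat \<Rightarrow> 'b) \<Rightarrow> star_var \<Rightarrow> 'b" where
  "var_value \<tau> a (X i) = a i"
| "var_value \<tau> a (Xstar i) = \<tau> (a i)"

definition star_eval ::
  "('a::field \<Rightarrow> 'b::ring_1 \<Rightarrow> 'b) \<Rightarrow> ('b \<Rightarrow> 'b) \<Rightarrow> (nat \<Rightarrow> 'b) \<Rightarrow> 'a star_poly \<Rightarrow> 'b" where
  "star_eval smul \<tau> a f =
     (\<Sum>w\<in>Poly_Mapping.keys f.
        smul (Poly_Mapping.lookup f w) (prod_list (map (var_value \<tau> a) w)))"

definition star_identities ::
  "('a::field \<Rightarrow> 'b::ring_1 \<Rightarrow> 'b) \<Rightarrow> ('b \<Rightarrow> 'b) \<Rightarrow> 'a star_poly set" where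
  "star_identities smul \<tau> = {f. \<forall>a. star_eval smul \<tau> a f = 0}"

definition star_central_polys ::
  "('a::field \<Rightarrow> 'b::ring_1 \<Rightarrow> 'b) \<Rightarrow> ('b \<Rightarrow> 'b) \<Rightarrow> 'a star_poly set" where
  "star_central_polys smul \<tau> = {f. \<forall>a. star_eval smul \<tau> a f \<in> center}"

typedef (overloaded) 'a ut2 = "{A :: 'a::field ^ 2 ^ 2. A $ 2 $ 1 = 0}"
  morphisms mat_of_ut2 ut2_of_mat
  by (rule exI[of _ 0]) simp

setup_lifting type_definition_ut2

instantiation ut2 :: (field) ring_1
begin

lift_definition zero_ut2 :: "'a ut2" is 0 by simp
lift_definition one_ut2 :: "'a ut2" is "mat 1" by (simp add: mat_def)
lift_definition plus_ut2 :: "'a ut2 \<Rightarrow> 'a ut2 \<Rightarrow> 'a ut2" is "(+)" by simp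
lift_definition minus_ut2 :: "'a ut2 \<Rightarrow> 'a ut2 \<Rightarrow> 'a ut2" is "(-)" by simp
lift_definition uminus_ut2 :: "'a ut2 \<Rightarrow> 'a ut2" is uminus by simp
lift_definition times_ut2 :: "'a ut2 \<Rightarrow> 'a ut2 \<Rightarrow> 'a ut2" is "(**)"
  by (simp add: matrix_matrix_mult_def sum_2)

instance
proof
  fix a b c :: "'a ut2"
  show "a * b * c = a * (b * c)"
    by transfer (simp add: matrix_mul_assoc)
  show "1 * a = a" "a * 1 = a"
    by (transfer, simp)+
  show "a + b + c = a + (b + c)" "a + b = b + a" "0 + a = a" "- a + a = 0" "a - b = a + - b"
    by (transfer, simp add: algebra_simps)+
  show "(a + b) * c = a * c + b * c" "a * (b + c) = a * b + a * c"
    by (transfer, simp add: vec_eq_iff matrix_matrix_mult_def sum_2 algebra_simps)+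
  show "(0::'a ut2) \<noteq> 1"
    by transfer (auto simp: mat_def vec_eq_iff)
qed

end

lift_definition scale_ut2 :: "'a::field \<Rightarrow> 'a ut2 \<Rightarrow> 'a ut2" is "\<lambda>c A. \<chi> i j. c * A $ i $ j"
  by simp

interpretation ut2: assoc_algebra scale_ut2
proof
  fix a b :: 'a and x y :: "'a ut2"
  show "scale_ut2 a (x + y) = scale_ut2 a x + scale_ut2 a y"
    "scale_ut2 (a + b) x = scale_ut2 a x + scale_ut2 b x"
    "scale_ut2 a (scale_ut2 b x) = scale_ut2 (a * b) x"
    "scale_ut2 1 x = x"
    by (transfer, simp add: vec_eq_iff algebra_simps)+
  show "scale_ut2 a x * y = scale_ut2 a (x * y)" "x * scale_ut2 a y = scale_ut2 a (x * y)"
    by (transfer, simp add: vec_eq_iff matrix_matrix_mult_def sum_2 algebra_simps)+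
qed

end

theory Submission
  imports Defs
begin

text \<open>An involution of the first kind on \<open>UT\<^sub>2(F)\<close> swaps the two diagonal entries: it preserves the
  line spanned by \<open>e\<^sub>1\<^sub>2\<close>, and reverses the relations \<open>e\<^sub>1\<^sub>1 e\<^sub>1\<^sub>2 = e\<^sub>1\<^sub>2\<close>, \<open>e\<^sub>1\<^sub>2 e\<^sub>1\<^sub>1 = 0\<close>.
  Hence \<open>x - x\<^sup>*\<close> has diagonal \<open>(d, -d)\<close> and its square is the scalar matrix \<open>d\<^sup>2\<close>. So
  \<open>(x - x\<^sup>*)\<^sup>2\<close> is central; it takes the value \<open>0\<close> at \<open>x = 0\<close> and \<open>1\<close> at \<open>x = e\<^sub>1\<^sub>1\<close>, and therefore
  is not a constant modulo the identities.\<close>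

context assoc_algebra
begin

text \<open>Cancellation can make the key set of a sum smaller than the union of the key sets, so
  sums are compared over a common index set.\<close>

lemma star_eval_superset:
  assumes "finite S" "Poly_Mapping.keys f \<subseteq> S"
  shows "star_eval smul \<tau> a f =
    (\<Sum>w\<in>S. smul (Poly_Mapping.lookup f w) (prod_list (map (var_value \<tau> a) w)))"
  unfolding star_eval_def using assms
  by (intro sum.mono_neutral_left) (auto simp: in_keys_iff)

lemma star_eval_add:
  "star_eval smul \<tau> a (f + g) = star_eval smul \<tau> a f + star_eval smul \<tau> a g"
proof -
  let ?S = "Poly_Mapping.keys f \<union> Poly_Mapping.keys g"
  have "Poly_Mapping.keys (f + g) \<subseteq> ?S"
    by (rule Poly_Mapping.keys_add)
  then show ?thesis
    by (simp add: star_eval_superset[where S = ?S] lookup_add scale_left_distrib sum.distrib)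
qed

lemma star_eval_single:
  "star_eval smul \<tau> a (Poly_Mapping.single w c) = smul c (prod_list (map (var_value \<tau> a) w))"
  by (simp add: star_eval_superset[where S = "{w}"])

end

definition square_skew :: "'a::field star_poly" where
  "square_skew = Poly_Mapping.single [X 0, X 0] 1 + Poly_Mapping.single [X 0, Xstar 0] (- 1)
     + Poly_Mapping.single [Xstar 0, X 0] (- 1) + Poly_Mapping.single [Xstar 0, Xstar 0] 1"

lemma (in assoc_algebra) star_eval_square_skew:
  "star_eval smul \<tau> a square_skew = (a 0 - \<tau> (a 0)) * (a 0 - \<tau> (a 0))"
  by (simp add: square_skew_def star_eval_add star_eval_single algebra_simps)

lift_definition ut2_entries :: "'a::field \<Rightarrow> 'a \<Rightarrow> 'a \<Rightarrow> 'a ut2" is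
  "\<lambda>a b c. \<chi> i j. if i = 1 then (if j = 1 then a else b) else (if j = 1 then 0 else c)"
  by simp

lemma ut2_entries_cases: obtains a b c where "x = ut2_entries a b c"
proof
  show "x = ut2_entries (mat_of_ut2 x $ 1 $ 1) (mat_of_ut2 x $ 1 $ 2) (mat_of_ut2 x $ 2 $ 2)"
    by transfer (simp add: vec_eq_iff forall_2)
qed

lemma ut2_entries_inject [simp]:
  "ut2_entries a b c = ut2_entries a' b' c' \<longleftrightarrow> a = a' \<and> b = b' \<and> c = c'"
  by transfer (auto simp: vec_eq_iff forall_2)

lemma ut2_entries_add [simp]:
  "ut2_entries a b c + ut2_entries a' b' c' = ut2_entries (a + a') (b + b') (c + c')"
  by transfer (simp add: vec_eq_iff forall_2)

lemma ut2_entries_diff [simp]: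
  "ut2_entries a b c - ut2_entries a' b' c' = ut2_entries (a - a') (b - b') (c - c')"
  by transfer (simp add: vec_eq_iff forall_2)

lemma ut2_entries_mult [simp]:
  "ut2_entries a b c * ut2_entries a' b' c' = ut2_entries (a * a') (a * b' + b * c') (c * c')"
  by transfer (simp add: vec_eq_iff forall_2 matrix_matrix_mult_def sum_2)

lemma one_ut2_entries: "1 = ut2_entries 1 0 1"
  by transfer (simp add: vec_eq_iff forall_2 mat_def)

lemma scale_ut2_entries [simp]:
  "scale_ut2 k (ut2_entries a b c) = ut2_entries (k * a) (k * b) (k * c)"
  by transfer (simp add: vec_eq_iff forall_2)

lemma scalar_ut2_in_center: "ut2_entries s 0 s \<in> center"
  unfolding center_def
proof (intro CollectI allI)
  fix x show "ut2_entries s 0 s * x = x * ut2_entries s 0 s"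
    by (cases x rule: ut2_entries_cases) (simp add: mult.commute)
qed

lemma first_kind_involution_swaps_diagonal:
  fixes \<tau> :: "'a::field ut2 \<Rightarrow> 'a ut2"
  assumes "involution \<tau>" and "first_kind \<tau>"
  obtains t where "\<tau> (ut2_entries a b c) = ut2_entries c t a"
proof -
  have add: "\<tau> (x + y) = \<tau> x + \<tau> y" and mult: "\<tau> (x * y) = \<tau> y * \<tau> x"
    and invol: "\<tau> (\<tau> x) = x" for x y
    using assms(1) unfolding involution_def by auto
  have scalar: "\<tau> (ut2_entries s 0 s) = ut2_entries s 0 s" for s
    using assms(2) scalar_ut2_in_center unfolding first_kind_def by blast
  have zero: "\<tau> (ut2_entries 0 0 0) = ut2_entries 0 0 0"
    by (rule scalar)
  define e n :: "'a ut2" where "e = ut2_entries 1 0 0" and "n = ut2_entries 0 1 0"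
  obtain p l q where n': "\<tau> n = ut2_entries p l q"
    by (rule ut2_entries_cases)
  \<comment> \<open>Since \<open>n\<close> squares to zero, so does its image, and a nilpotent
    triangular matrix over a field has zero diagonal.\<close>
  have "\<tau> n * \<tau> n = ut2_entries 0 0 0"
    using mult[of n n] zero by (simp add: n_def)
  then have pq: "p = 0" "q = 0"
    by (auto simp: n')
  have "l \<noteq> 0"
  proof
    assume "l = 0"
    then have "n = ut2_entries 0 0 0"
      using invol[of n] zero by (simp add: n' pq)
    then show False
      by (simp add: n_def)
  qed
  obtain u v w where e': "\<tau> e = ut2_entries u v w"
    by (rule ut2_entries_cases)
  \<comment> \<open>In the upper right entries these reversed relations read
    \<open>l * w = l\<close> and \<open>u * l = 0\<close>, and \<open>l\<close> cancels.\<close>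
  have "\<tau> n * \<tau> e = \<tau> n" "\<tau> e * \<tau> n = ut2_entries 0 0 0"
    using mult[of e n] mult[of n e] zero by (simp_all add: e_def n_def)
  with \<open>l \<noteq> 0\<close> have uw: "u = 0" "w = 1"
    by (auto simp: n' e' pq)
  \<comment> \<open>An involution is only assumed additive. Writing coefficients as scalar matrices,
    which are central and hence fixed by \<tau>, gives linearity.\<close>
  have "ut2_entries a b c =
      ut2_entries c 0 c + (ut2_entries (a - c) 0 (a - c) * e + ut2_entries b 0 b * n)"
    by (simp add: e_def n_def)
  then have "\<tau> (ut2_entries a b c) =
      ut2_entries c 0 c + (\<tau> e * ut2_entries (a - c) 0 (a - c) + \<tau> n * ut2_entries b 0 b)"
    by (simp only: add mult scalar)
  then have "\<tau> (ut2_entries a b c) = ut2_entries c (v * (a - c) + l * b) a"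
    by (simp add: e' n' uw pq)
  then show thesis
    by (rule that)
qed

text \<open>The diagonal entries of \<open>x - \<tau> x\<close> are opposite, so its upper right
  entry, whatever it is, cancels in the square.\<close>

lemma square_skew_ut2:
  fixes \<tau> :: "'a::field ut2 \<Rightarrow> 'a ut2"
  assumes "involution \<tau>" and "first_kind \<tau>" and x: "x = ut2_entries a b c"
  shows "(x - \<tau> x) * (x - \<tau> x) = ut2_entries ((a - c) * (a - c)) 0 ((a - c) * (a - c))"
proof -
  obtain t where "\<tau> x = ut2_entries c t a"
    unfolding x by (rule first_kind_involution_swaps_diagonal[OF assms(1,2)])
  then show ?thesis
    by (simp add: x algebra_simps)
qed

theorem mainTheorem2:
  fixes \<tau> :: "'a::field ut2 \<Rightarrow> 'a ut2"
  assumes "CHAR('a) \<noteq> 2"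
    and "involution \<tau>"
    and "first_kind \<tau>"
  shows "star_central_polys scale_ut2 \<tau> \<noteq> star_identities scale_ut2 \<tau> + constants"
proof
  assume eq: "star_central_polys scale_ut2 \<tau> = star_identities scale_ut2 \<tau> + constants"
  note eval = ut2.star_eval_square_skew square_skew_ut2[OF assms(2,3) refl]
  have "star_eval scale_ut2 \<tau> a square_skew \<in> center" for a
  proof -
    obtain p r q where "a 0 = ut2_entries p r q"
      by (rule ut2_entries_cases)
    then show ?thesis
      by (simp add: eval scalar_ut2_in_center)
  qed
  then have "square_skew \<in> star_identities scale_ut2 \<tau> + constants"
    unfolding eq[symmetric] star_central_polys_def by blast
  then obtain g k where g: "g \<in> star_identities scale_ut2 \<tau>"
    and split: "square_skew = g + Poly_Mapping.single 0 k"
    by (auto simp: constants_def elim!: set_plus_elim)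
  \<comment> \<open>The identity \<open>g\<close> contributes zero, and the constant evaluates to
    \<open>k\<close> times the empty product, independently of \<open>a\<close>.\<close>
  have const: "star_eval scale_ut2 \<tau> a square_skew = ut2_entries k 0 k" for a
    using g by (simp add: split ut2.star_eval_add ut2.star_eval_single star_identities_def
        zero_list_def one_ut2_entries)
  have "k = 0"
    using const[of "\<lambda>_. ut2_entries 0 0 0"] by (simp add: eval)
  moreover have "k = 1"
    using const[of "\<lambda>_. ut2_entries 1 0 0"] by (simp add: eval)
  ultimately show False
    by simp
qed

end
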